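(* Let $n$ be a positive integer, let $m_1,\dots,m_n$ be integers, and let $m$ be such that $2\le m_i\le m$ for $i=1,\dots,n$. Then \[r_3(\mathbb{Z}_{m_1}\times\dots\times\mathbb{Z}_{m_n})\ge \frac{(7/24)^{n/2}}{10^{6}m^2n^3}\cdot m_1\cdots m_n.\]
   Context: For a finite abelian group $G$, $r_3(G)$ denotes the maximum possible size of a subset $A\subseteq G$ such that there do not exist distinct $x,y,z\in A$ with $x+z=y+y$. $\mathbb{Z}_k$ denotes the cyclic group $\mathbb{Z}/k\mathbb{Z}$. *)

theory Defs
  imports Complex_Main "HOL-Algebra.Product_Groups"
begin

definition three_AP_free :: "('a, 'b) monoid_scheme \<Rightarrow> 'a set \<Rightarrow> bool" where
  "three_AP_free G A \<longleftrightarrow>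
     \<not> (\<exists>x\<in>A. \<exists>y\<in>A. \<exists>z\<in>A. x \<noteq> y \<and> y \<noteq> z \<and> x \<noteq> z \<and> x \<otimes>\<^bsub>G\<^esub> z = y \<otimes>\<^bsub>G\<^esub> y)"

(* Only meaningful if carrier G is finite: otherwise Max may be taken over an infinite set. *)
definition r3 :: "('a, 'b) monoid_scheme \<Rightarrow> nat" where
  "r3 G = Max {card A | A. A \<subseteq> carrier G \<and> three_AP_free G A}"

(* Elements are the extensional functions on {1..n} with i-th value in {0..<int (m i)},
   added coordinatewise modulo m i; this is only meant for m i > 0, since
   integer_mod_group 0 is the infinite cyclic group. *)
definition cyclic_product :: "nat \<Rightarrow> (nat \<Rightarrow> nat) \<Rightarrow> (nat \<Rightarrow> int) monoid" where
  "cyclic_product n m = product_group {1..n} (\<lambda>i. integer_mod_group (m i))"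

lemma r3_attained:
  assumes "finite (carrier G)"
  obtains A where "A \<subseteq> carrier G" "three_AP_free G A" "card A = r3 G"
proof -
  let ?S = "{card A | A. A \<subseteq> carrier G \<and> three_AP_free G A}"
  have "?S \<subseteq> card ` Pow (carrier G)" by auto
  then have "finite ?S" by (rule finite_subset) (simp add: assms)
  moreover have "three_AP_free G {}" by (simp add: three_AP_free_def)
  then have "?S \<noteq> {}" by blast
  ultimately have "Max ?S \<in> ?S" by (rule Max_in)
  then show thesis using that by (auto simp: r3_def)
qed

lemma card_le_r3:
  assumes "finite (carrier G)" "A \<subseteq> carrier G" "three_AP_free G A"
  shows "card A \<le> r3 G"
proof -
  let ?S = "{card A | A. A \<subseteq> carrier G \<and> three_AP_free G A}"
  have "?S \<subseteq> card ` Pow (carrier G)" by auto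
  then have "finite ?S" by (rule finite_subset) (simp add: assms)
  then show ?thesis unfolding r3_def using assms(2,3) by (intro Max_ge) auto
qed

lemma comm_group_cyclic_product: "comm_group (cyclic_product n m)"
  unfolding cyclic_product_def
  by (rule group.group_comm_groupI) (simp_all add: add.commute)

lemma finite_cyclic_product:
  assumes "\<And>i. i \<in> {1..n} \<Longrightarrow> m i > 0"
  shows "finite (carrier (cyclic_product n m))"
  unfolding cyclic_product_def using assms
  by (auto simp: carrier_integer_mod_group intro!: finite_PiE)

end

theory Submission
  imports Defs
begin

text \<open>As in Behrend's construction, one looks for a large subset of the torus carrying a function
  that is strictly convex along all three-term progressions inside the subset; restricting a
  product of such subsets to a level shell of the summed functions kills all nontrivial
  progressions. Using \<open>[0, 1/2)\<close> in every coordinate gives density \<open>1/4\<close> per pair of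
  coordinates. In the two-dimensional torus one does better: cut a corner triangle off the square
  \<open>[0, 1/2)\<^sup>2\<close> and add two translates, differing by \<open>(1/2, 0)\<close>, of a truncated triangle that
  lies over the removed corner modulo \<open>1/2\<close>. The wrap-around progressions this creates are
  handled by adding to the quadratic a large multiple of the depth \<open>b\<close> in the added pieces, and
  the total area is \<open>7/36 + 7/72 = 7/24\<close>. A strip of relative width \<open>1/n\<close> is removed to make
  that convexity quantitative, at the cost of only a constant factor over all pairs. The torus is
  replaced by a fine grid, and a coset of the two cyclic factors in the grid that meets the tile
  in at least the average number of points provides the block for two coordinates; an odd last
  coordinate is paired with the trivial group.\<close>

section \<open>The tile in the discrete torus and its convex potential\<close>

text \<open>Half the torus side is \<open>6 * l\<close>. The cut \<open>i + j < 8 * l\<close>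
  removes from the corner of the square a triangle with legs \<open>4 * l\<close>, one third of the
  side.\<close>

definition pentagon :: "int \<Rightarrow> int \<Rightarrow> (int \<times> int) set" where
  "pentagon l e = {(i, j). 0 \<le> i \<and> i < 6 * l \<and> e \<le> j \<and> j < 6 * l \<and> i + j < 8 * l}"

text \<open>The coordinates are depths, measured backwards from the point
  \<open>(6 * l * c, 12 * l)\<close> when copy \<open>c\<close> is placed in the torus. The triangle
  with legs \<open>4 * l\<close> is truncated at a quarter of the side.\<close>

definition wedge :: "int \<Rightarrow> int \<Rightarrow> (int \<times> int) set" where
  "wedge l e = {(a, b). 1 \<le> a \<and> a \<le> 3 * l \<and> e \<le> b \<and> b \<le> 3 * l \<and> a + b \<le> 4 * l}"

text \<open>The torus is the grid of integer pairs modulo \<open>12 * l\<close>; \<open>e\<close> is the width of the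
  removed strip.\<close>

definition tile :: "int \<Rightarrow> int \<Rightarrow> (int \<times> int) set" where
  "tile l e = pentagon l e \<union> (\<Union>c\<in>{1, 2}. (\<lambda>(a, b). (6 * l * c - a, 12 * l - b)) ` wedge l e)"

text \<open>The comparison of \<open>j\<close> with \<open>6 * l\<close> detects the pentagon, that
  of \<open>i\<close> the copy of the wedge. Both copies carry the same function of the depths, with
  the linear term \<open>w * b\<close>.\<close>

definition potential :: "int \<Rightarrow> int \<Rightarrow> int \<times> int \<Rightarrow> int" where
  "potential l w = (\<lambda>(i, j).
     if j < 6 * l then i\<^sup>2 + j\<^sup>2
     else w * (12 * l - j) + ((if i < 6 * l then 6 * l else 12 * l) - i)\<^sup>2 + (12 * l - j)\<^sup>2)"

lemma tile_cases [consumes 1, case_names pentagon wedge]: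
  assumes "x \<in> tile l e"
  obtains i j where "x = (i, j)" "0 \<le> i" "i < 6 * l" "e \<le> j" "j < 6 * l" "i + j < 8 * l"
      "potential l w x = i\<^sup>2 + j\<^sup>2"
  | a b c where "x = (6 * l * c - a, 12 * l - b)" "c = 1 \<or> c = 2"
      "1 \<le> a" "a \<le> 3 * l" "e \<le> b" "b \<le> 3 * l" "a + b \<le> 4 * l"
      "potential l w x = w * b + a\<^sup>2 + b\<^sup>2"
proof -
  have "x \<in> pentagon l e \<or> (\<exists>c a b. (c = 1 \<or> c = 2) \<and> (a, b) \<in> wedge l e \<and> x = (6 * l * c - a, 12 * l - b))"
    using assms by (auto simp: tile_def)
  then show thesis
  proof (elim disjE exE conjE)
    assume "x \<in> pentagon l e"
    then show thesis by (auto simp: pentagon_def potential_def intro: that(1))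
  next
    fix c a b assume "c = 1" "(a, b) \<in> wedge l e" "x = (6 * l * c - a, 12 * l - b)"
    then show thesis by (intro that(2)[of c a b]) (auto simp: wedge_def potential_def)
  next
    fix c a b assume "c = 2" "(a, b) \<in> wedge l e" "x = (6 * l * c - a, 12 * l - b)"
    then show thesis by (intro that(2)[of c a b]) (auto simp: wedge_def potential_def)
  qed
qed

text \<open>Excludes wrap-around: a congruence between sufficiently close integers is an
  equality.\<close>

lemma small_multiple_zero:
  fixes x m :: int
  assumes "m dvd x" "\<bar>x\<bar> < m"
  shows "x = 0"
  using dvd_imp_le_int[OF _ assms(1)] assms(2) by (cases "x = 0") auto

lemma midpoint_gap:
  fixes x y z :: int
  assumes "x + z = 2 * y"
  shows "2 * (x\<^sup>2 + z\<^sup>2 - 2 * y\<^sup>2) = (x - z)\<^sup>2"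
proof -
  have z: "z = 2 * y - x" using assms by simp
  show ?thesis unfolding z by (simp add: power2_eq_square algebra_simps)
qed

text \<open>The linear part of the potential gains at least \<open>w * e\<close>, except on progressions lying
  entirely in the pentagon or entirely in the copies of the wedge; its second difference vanishes
  on those, and as they do not wrap around, the strictly convex quadratic part decides.\<close>

lemma tile_progression:
  assumes l: "l > 0" and e: "e > 0" and w: "w * e \<ge> 216 * l\<^sup>2" "w \<ge> 0"
    and mem: "x \<in> tile l e" "y \<in> tile l e" "z \<in> tile l e"
    and d1: "12 * l dvd fst x + fst z - 2 * fst y" and d2: "12 * l dvd snd x + snd z - 2 * snd y"
  defines "gap \<equiv> potential l w x + potential l w z - 2 * potential l w y"
  shows "gap \<ge> 72 * l\<^sup>2 \<or> 2 * gap = (fst x - fst z)\<^sup>2 + (snd x - snd z)\<^sup>2"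
proof -
  have sq: "i\<^sup>2 \<le> (c * l)\<^sup>2" if "0 \<le> i" "i \<le> c * l" for i c :: int
    using that by (intro power_mono) auto
  have wb: "w * b \<ge> 216 * l\<^sup>2" if "b \<ge> e" for b
    using mult_left_mono[OF that w(2)] w(1) by linarith
  have wq: "w * b + a\<^sup>2 + b\<^sup>2 \<ge> 216 * l\<^sup>2" if "b \<ge> e" for a b
    using wb[OF that] zero_le_power2[of a] zero_le_power2[of b] by linarith
  have pent: "i\<^sup>2 + j\<^sup>2 \<le> 72 * l\<^sup>2" if "0 \<le> i" "i < 6 * l" "e \<le> j" "j < 6 * l" for i j
    using sq[of i 6] sq[of j 6] that e by (simp add: power_mult_distrib)
  have wed: "a\<^sup>2 + b\<^sup>2 \<le> 18 * l\<^sup>2" if "1 \<le> a" "a \<le> 3 * l" "e \<le> b" "b \<le> 3 * l" for a b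
    using sq[of a 3] sq[of b 3] that e by (simp add: power_mult_distrib)
  show ?thesis using mem(2)
  proof (cases rule: tile_cases[where w = w])
    case (pentagon i' j')
    note y = this
    \<comment> \<open>An end of the progression in a wedge copy now suffices, the other end being
      nonnegative: 216 - 2 * 72 = 72.\<close>
    have fy: "potential l w y \<le> 72 * l\<^sup>2" using pent y by simp
    have nn: "potential l w p \<ge> 0" if "p \<in> tile l e" for p
      using that by (cases rule: tile_cases[where w = w]) (use e w in auto)
    show ?thesis using mem(1)
    proof (cases rule: tile_cases[where w = w])
      case (pentagon i j)
      note x = this
      show ?thesis using mem(3)
      proof (cases rule: tile_cases[where w = w])
        case (pentagon i2 j2)
        have "i + i2 - 2 * i' = 0"
          by (rule small_multiple_zero[of "12 * l"]) (use d1 x y pentagon e in auto)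
        moreover have "j + j2 - 2 * j' = 0"
          by (rule small_multiple_zero[of "12 * l"]) (use d2 x y pentagon e in auto)
        ultimately have "i + i2 = 2 * i'" "j + j2 = 2 * j'" by auto
        from midpoint_gap[OF this(1)] midpoint_gap[OF this(2)] show ?thesis
          using x y pentagon by (simp add: gap_def)
      next
        case (wedge a b c)
        have "potential l w z \<ge> 216 * l\<^sup>2" using wedge(5,8) wq[of b a] by simp
        then show ?thesis using fy nn[OF mem(1)] by (simp add: gap_def)
      qed
    next
      case (wedge a b c)
      have "potential l w x \<ge> 216 * l\<^sup>2" using wedge(5,8) wq[of b a] by simp
      then show ?thesis using fy nn[OF mem(3)] by (simp add: gap_def)
    qed
  next
    case (wedge a' b' c')
    note y = this
    have dvd1: "12 * l dvd i + 2 * a'" if "12 * l dvd i - 2 * (6 * l * c' - a')" for i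
      using dvd_add[OF that dvd_triv_left[of "12 * l" c']] by (simp add: algebra_simps)
    have dvd2: "12 * l dvd j + 2 * b'" if "12 * l dvd j - 2 * (12 * l - b')" for j
      using dvd_add[OF that dvd_triv_left[of "12 * l" 2]] by (simp add: algebra_simps)
    have mixed: "potential l w p + potential l w q - 2 * potential l w y \<ge> 72 * l\<^sup>2"
      if p: "p = (i, j)" "0 \<le> i" "i < 6 * l" "e \<le> j" "j < 6 * l" "potential l w p = i\<^sup>2 + j\<^sup>2"
        and q: "q = (6 * l * c - a, 12 * l - b)" "1 \<le> a" "a \<le> 3 * l" "e \<le> b" "b \<le> 3 * l"
          "potential l w q = w * b + a\<^sup>2 + b\<^sup>2"
        and d: "12 * l dvd snd p + snd q - 2 * snd y" for p q i j a b c
    proof -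
      have "12 * l dvd j + (12 * l - b) + 2 * b'"
        using dvd2[of "j + (12 * l - b)"] d p q y by simp
      then have "12 * l dvd 12 * l + (j - b + 2 * b')" by (simp add: algebra_simps)
      then have "12 * l dvd j - b + 2 * b'" by (simp add: dvd_add_right_iff)
      then have "j - b + 2 * b' = 0" 
        by (rule small_multiple_zero) (use p q y e l in auto)
      then have b: "b = j + 2 * b'" by simp
      \<comment> \<open>The linear terms leave \<open>w * j\<close>, at least
        \<open>216 * l\<^sup>2\<close>, while the squares at \<open>y\<close> cost at most
        \<open>36 * l\<^sup>2\<close>.\<close>
      have "w * b = w * j + 2 * (w * b')" unfolding b by (simp add: algebra_simps)
      then show ?thesis using wb[OF p(4)] wed[OF y(3-6)] p(6) q(6) y(8)
          zero_le_power2[of i] zero_le_power2[of j] zero_le_power2[of a] zero_le_power2[of b]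
          zero_le_power2[of l]
        by linarith
    qed
    show ?thesis using mem(1)
    proof (cases rule: tile_cases[where w = w])
      case (pentagon i j)
      note x = this
      show ?thesis using mem(3)
      proof (cases rule: tile_cases[where w = w])
        case (pentagon i2 j2)
        have "12 * l dvd i + i2 + 2 * a'" "12 * l dvd j + j2 + 2 * b'"
          using dvd1[of "i + i2"] dvd2[of "j + j2"] d1 d2 x y pentagon by auto
        then have "12 * l \<le> i + i2 + 2 * a'" "12 * l \<le> j + j2 + 2 * b'"
          using x y pentagon e by (auto intro!: zdvd_imp_le)
        \<comment> \<open>Impossible: the two sums add up to at least \<open>24 * l\<close>, but the
          slanted cuts \<open>i + j < 8 * l\<close> (twice) and \<open>a' + b' \<le> 4 * l\<close>
          (doubled) keep the total below that. This is why the two cuts match.\<close>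
        then show ?thesis using x y pentagon by linarith
      next
        case (wedge a b c)
        show ?thesis unfolding gap_def
          by (intro disjI1 mixed[of x i j z c a b]) (use x wedge d2 in auto)
      qed
    next
      case (wedge a b c)
      note x = this
      show ?thesis using mem(3)
      proof (cases rule: tile_cases[where w = w])
        case (pentagon i j)
        have "potential l w z + potential l w x - 2 * potential l w y \<ge> 72 * l\<^sup>2"
          by (intro mixed[of z i j x c a b]) (use x pentagon d2 in \<open>auto simp: algebra_simps\<close>)
        then show ?thesis by (simp add: gap_def)
      next
        case (wedge a2 b2 c2)
        have "12 * l dvd (12 * l - b) + (12 * l - b2) + 2 * b'"
          using dvd2[of "(12 * l - b) + (12 * l - b2)"] d2 x y wedge by simp
        then have "12 * l dvd 12 * l * 2 + (2 * b' - b - b2)" by (simp add: algebra_simps)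
        then have "12 * l dvd 2 * b' - b - b2" by (simp add: dvd_add_right_iff)
        then have "2 * b' - b - b2 = 0"
          by (rule small_multiple_zero) (use x y wedge e l in auto)
        then have bb: "b + b2 = 2 * b'" by simp
        have "12 * l dvd (6 * l * c - a) + (6 * l * c2 - a2) + 2 * a'"
          using dvd1[of "(6 * l * c - a) + (6 * l * c2 - a2)"] d1 x y wedge by simp
        then have D: "12 * l dvd 6 * l * (c + c2) + (2 * a' - a - a2)" by (simp add: algebra_simps)
        \<comment> \<open>Passing to the modulus \<open>6 * l\<close> ignores which copies are
          involved; the truncation at \<open>3 * l\<close> still leaves no room to wrap
          around.\<close>
        then have "6 * l dvd 6 * l * (c + c2) + (2 * a' - a - a2)"
          by (rule dvd_trans[rotated]) simp
        then have "6 * l dvd 2 * a' - a - a2" by (simp add: dvd_add_right_iff)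
        then have a0: "2 * a' - a - a2 = 0"
          by (rule small_multiple_zero) (use x y wedge e l in auto)
        \<comment> \<open>The copy containing \<open>y\<close> is irrelevant, since doubling
          identifies both copies. Ends in different copies would make \<open>18 * l\<close> a
          multiple of \<open>12 * l\<close>.\<close>
        have "c = c2"
        proof (rule ccontr)
          assume "c \<noteq> c2"
          then have "c + c2 = 3" using x wedge by auto
          then have "12 * l dvd 6 * l * 3" using D a0 by simp
          then have "12 * l dvd 12 * l * 1 + 6 * l" by (simp add: algebra_simps)
          then have "12 * l dvd 6 * l" by (simp only: dvd_add_right_iff dvd_triv_left)
          with l zdvd_imp_le[of "12 * l" "6 * l"] show False by simp
        qed
        have aa: "a + a2 = 2 * a'" using a0 by simp
        have "w * b + w * b2 = 2 * (w * b')" using bb by (metis distrib_left mult.left_commute)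
        then show ?thesis using midpoint_gap[OF aa] midpoint_gap[OF bb] x y wedge \<open>c = c2\<close>
          by (simp add: gap_def power2_commute algebra_simps)
      qed
    qed
  qed
qed

section \<open>Counting the points of the tile\<close>

text \<open>Row \<open>y\<close> contributes \<open>y\<close> points; the factor 2 avoids
  division.\<close>

lemma card_trapezoid:
  fixes p q :: int
  assumes "0 \<le> p" "p \<le> q"
  shows "2 * int (card {(x, y). p \<le> y \<and> y < q \<and> 0 \<le> x \<and> x < y}) = q * (q - 1) - p * (p - 1)"
  using assms(2)
proof (induction q rule: int_ge_induct)
  case base
  have empty: "{(x, y). p \<le> y \<and> y < p \<and> 0 \<le> x \<and> x < y} = {}" by auto
  show ?case unfolding empty by simp
next
  case (step q)
  let ?T = "{(x, y). p \<le> y \<and> y < q \<and> 0 \<le> x \<and> x < y}"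
  have "{(x, y). p \<le> y \<and> y < q + 1 \<and> 0 \<le> x \<and> x < y} = ?T \<union> {0..<q} \<times> {q}"
    using step.hyps by auto
  moreover have "finite ?T"
    by (rule finite_subset[of _ "{0..<q} \<times> {p..<q}"]) auto
  moreover have "?T \<inter> {0..<q} \<times> {q} = {}" by auto
  ultimately show ?case
    using step assms(1) by (simp add: card_Un_disjoint algebra_simps)
qed

lemma card_pentagon:
  assumes "0 < e" "e \<le> l"
  shows "int (card (pentagon l e)) = 28 * l\<^sup>2 + 2 * l - 6 * l * e"
proof -
  \<comment> \<open>Rows below height \<open>2 * l\<close> are full. From there on the slanted edge
    limits row \<open>j\<close> to \<open>8 * l - j\<close> points, and \<open>?g\<close> reflects
    these rows onto a trapezoid.\<close>
  let ?T = "{(x, y). 2 * l + 1 \<le> y \<and> y < 6 * l + 1 \<and> 0 \<le> x \<and> x < y}"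
  let ?g = "\<lambda>(x, y). (x, 8 * l - y)"
  have "pentagon l e = {0..<6 * l} \<times> {e..<2 * l} \<union> ?g ` ?T" (is "_ = ?R \<union> _")
  proof (intro equalityI subsetI)
    fix v assume "v \<in> pentagon l e"
    then show "v \<in> ?R \<union> ?g ` ?T"
      by (cases v, cases "snd v < 2 * l")
        (auto simp: pentagon_def intro!: image_eqI[of _ _ "(fst v, 8 * l - snd v)"])
  qed (use assms in \<open>auto simp: pentagon_def\<close>)
  moreover have "finite ?T"
    by (rule finite_subset[of _ "{0..<6 * l + 1} \<times> {2 * l + 1..<6 * l + 1}"]) auto
  moreover have "?R \<inter> ?g ` ?T = {}" by auto
  moreover have "card (?g ` ?T) = card ?T" by (intro card_image inj_onI) auto
  ultimately have "card (pentagon l e) = card ?R + card ?T" by (simp add: card_Un_disjoint)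
  moreover have "int (card ?R) = 6 * l * (2 * l - e)" using assms by simp
  ultimately show ?thesis
    using card_trapezoid[of "2 * l + 1" "6 * l + 1"] assms
    by (simp add: power2_eq_square algebra_simps)
qed

lemma card_wedge:
  assumes "0 < e" "e \<le> l"
  shows "int (card (wedge l e)) = 7 * l\<^sup>2 + 2 * l - 3 * l * e"
proof -
  let ?T = "{(x, y). l \<le> y \<and> y < 3 * l \<and> 0 \<le> x \<and> x < y}"
  let ?g = "\<lambda>(x, y). (x + 1, 4 * l - y)"
  have "wedge l e = {1..3 * l} \<times> {e..l} \<union> ?g ` ?T" (is "_ = ?R \<union> _")
  proof (intro equalityI subsetI)
    fix v assume "v \<in> wedge l e"
    then show "v \<in> ?R \<union> ?g ` ?T"
      by (cases v, cases "snd v \<le> l")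
        (auto simp: wedge_def intro!: image_eqI[of _ _ "(fst v - 1, 4 * l - snd v)"])
  qed (use assms in \<open>auto simp: wedge_def\<close>)
  moreover have "finite ?T"
    by (rule finite_subset[of _ "{0..<3 * l} \<times> {l..<3 * l}"]) auto
  moreover have "?R \<inter> ?g ` ?T = {}" by auto
  moreover have "card (?g ` ?T) = card ?T" by (intro card_image inj_onI) auto
  ultimately have "card (wedge l e) = card ?R + card ?T" by (simp add: card_Un_disjoint)
  moreover have "int (card ?R) = 3 * l * (l - e + 1)" using assms by simp
  ultimately show ?thesis
    using card_trapezoid[of l "3 * l"] assms by (simp add: power2_eq_square algebra_simps)
qed

lemma tile_subset:
  assumes "0 < e" "e \<le> l"
  shows "tile l e \<subseteq> {0..<12 * l} \<times> {0..<12 * l}"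
  using assms by (auto simp: tile_def pentagon_def wedge_def)

text \<open>The leading terms are 28 + 2 * 7 = 42 and 6 + 2 * 3 = 12, and 42/144 = 7/24; the
  positive terms linear in \<open>l\<close> are dropped.\<close>

lemma card_tile:
  assumes "0 < e" "e \<le> l"
  shows "int (card (tile l e)) \<ge> 42 * l\<^sup>2 - 12 * l * e"
proof -
  let ?g = "\<lambda>c (a, b). (6 * l * c - a, 12 * l - b)"
  have fin: "finite (wedge l e)" "finite (pentagon l e)"
    by (rule finite_subset[of _ "{1..3 * l} \<times> {e..3 * l}"],
        auto simp: wedge_def)
      (rule finite_subset[of _ "{0..<6 * l} \<times> {e..<6 * l}"], auto simp: pentagon_def)
  have im: "card (?g c ` wedge l e) = card (wedge l e)" for c
    by (intro card_image inj_onI) auto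
  have "pentagon l e \<inter> (?g 1 ` wedge l e \<union> ?g 2 ` wedge l e) = {}"
    "?g 1 ` wedge l e \<inter> ?g 2 ` wedge l e = {}"
    using assms by (auto simp: pentagon_def wedge_def)
  moreover have "tile l e = pentagon l e \<union> (?g 1 ` wedge l e \<union> ?g 2 ` wedge l e)"
    by (simp add: tile_def)
  ultimately have "card (tile l e) = card (pentagon l e) + 2 * card (wedge l e)"
    using fin im[of 1] im[of 2] by (simp add: card_Un_disjoint)
  then show ?thesis using card_pentagon[OF assms] card_wedge[OF assms] assms by simp
qed

section \<open>Convex blocks in a product of two cyclic groups\<close>

lemma potential_bounds:
  assumes "x \<in> tile l e" "l > 0" "e > 0" "w \<ge> 0"
  shows "0 \<le> potential l w x" "potential l w x \<le> 3 * w * l + 72 * l\<^sup>2"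
proof -
  have sq: "i\<^sup>2 \<le> 36 * l\<^sup>2" if "0 \<le> i" "i \<le> 6 * l" for i
    using power_mono[OF that(2,1), of 2] by (simp add: power_mult_distrib)
  show "0 \<le> potential l w x"
    using assms(1) by (cases rule: tile_cases[where w = w]) (use assms in auto)
  show "potential l w x \<le> 3 * w * l + 72 * l\<^sup>2"
    using assms(1)
  proof (cases rule: tile_cases[where w = w])
    case (pentagon i j)
    have "0 \<le> 3 * w * l" using assms by simp
    then show ?thesis using pentagon(7) sq[of i] sq[of j] pentagon(2-5) assms by linarith
  next
    case (wedge a b c)
    have "w * b \<le> w * (3 * l)" using wedge assms by (intro mult_left_mono) auto
    then show ?thesis using wedge sq[of a] sq[of b] assms by simp
  qed
qed

text \<open>The multiples of \<open>c1\<close> and \<open>c2\<close> form a subgroup with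
  \<open>c1 * c2\<close> cosets, indexed by pairs of residues. Some coset meets \<open>T\<close> in
  at least the average number of points, and quotients serve as coordinates on it.\<close>

lemma exists_dense_coset:
  fixes c1 c2 m1 m2 :: int
  assumes "c1 > 0" "c2 > 0" and T: "T \<subseteq> {0..<c1 * m1} \<times> {0..<c2 * m2}"
  obtains s t U where "U \<subseteq> {0..<m1} \<times> {0..<m2}"
    "\<And>u v. (u, v) \<in> U \<Longrightarrow> (s + c1 * u, t + c2 * v) \<in> T"
    "int (card T) \<le> int (card U) * (c1 * c2)"
proof -
  let ?g = "\<lambda>(i, j). (i mod c1, j mod c2)" and ?h = "\<lambda>(i, j). (i div c1, j div c2)"
  let ?I = "{0..<c1} \<times> {0..<c2}"
  have "finite T" using finite_subset[OF T] by simp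
  moreover have "?g \<in> T \<rightarrow> ?I" using assms by auto
  moreover have "?I \<noteq> {}" using assms by auto
  ultimately obtain s t where st: "card T \<le> card (?g -` {(s, t)} \<inter> T) * card ?I"
    using pigeonhole_card[of ?g T ?I] by auto
  define F where "F = ?g -` {(s, t)} \<inter> T"
  have F: "(i, j) \<in> F \<longleftrightarrow> i mod c1 = s \<and> j mod c2 = t \<and> (i, j) \<in> T" for i j
    by (auto simp: F_def)
  have "inj_on ?h F"
  proof (rule inj_onI, clarify)
    fix i j i' j'
    assume "(i, j) \<in> F" "(i', j') \<in> F" "i div c1 = i' div c1" "j div c2 = j' div c2"
    then show "i = i' \<and> j = j'"
      unfolding F by (metis div_mult_mod_eq)
  qed
  then have "card (?h ` F) = card F" by (rule card_image)
  moreover have "int (card ?I) = c1 * c2" using assms by simp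
  ultimately have "int (card T) \<le> int (card (?h ` F)) * (c1 * c2)"
    using st unfolding F_def by (metis of_nat_le_iff of_nat_mult)
  moreover have "?h ` F \<subseteq> {0..<m1} \<times> {0..<m2}"
  proof (clarify)
    have less: "i div c < m" if "i < c * m" "c > 0" for i c m :: int
    proof -
      have "c * (i div c) \<le> i"
        using pos_mod_sign[OF that(2), of i] mult_div_mod_eq[of c i] by linarith
      then have "c * (i div c) < c * m" using that(1) by linarith
      then show ?thesis using that(2) by simp
    qed
    fix i j assume "(i, j) \<in> F"
    then have "0 \<le> i" "i < c1 * m1" "0 \<le> j" "j < c2 * m2" using T by (auto simp: F)
    then show "i div c1 \<in> {0..<m1} \<and> j div c2 \<in> {0..<m2}"
      using assms less by (auto simp: pos_imp_zdiv_nonneg_iff)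
  qed
  moreover have "(s + c1 * u, t + c2 * v) \<in> T" if "(u, v) \<in> ?h ` F" for u v
  proof -
    from that obtain i j where "(i, j) \<in> F" "u = i div c1" "v = j div c2" by auto
    then show ?thesis by (auto simp: F)
  qed
  ultimately show thesis using that by blast
qed

lemma exists_convex_block:
  fixes m1 m2 n :: nat and M :: real
  assumes pos: "m1 > 0" "m2 > 0" "n > 0" and M: "real m1 \<le> M" "real m2 \<le> M"
  shows "\<exists>S f. S \<subseteq> {0..<int m1} \<times> {0..<int m2} \<and>
    7 / 24 * (1 - 2 / (7 * real n)) * (real m1 * real m2) \<le> real (card S) \<and>
    (\<forall>x\<in>S. 0 \<le> f x \<and> f x \<le> 720 * real n) \<and>
    (\<forall>x\<in>S. \<forall>y\<in>S. \<forall>z\<in>S.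
      int m1 dvd fst x + fst z - 2 * fst y \<longrightarrow> int m2 dvd snd x + snd z - 2 * snd y \<longrightarrow>
      (if x = z then 0 else 72 / M\<^sup>2) \<le> f x + f z - 2 * f y)"
proof -
  \<comment> \<open>The side \<open>12 * l\<close> is a multiple of \<open>m1\<close> and of
    \<open>m2\<close>, so both groups embed in the grid with spacings \<open>c1\<close> and
    \<open>c2\<close>. The ratio \<open>e / l\<close> is \<open>1 / n\<close>, and \<open>w\<close>
    is chosen to make \<open>w * e\<close> equal to \<open>216 * l\<^sup>2\<close>.\<close>
  define e where "e = int m1 * int m2"
  define l where "l = int n * e"
  define w where "w = 216 * int n * l"
  define c1 where "c1 = 12 * int n * int m2"
  define c2 where "c2 = 12 * int n * int m1"
  have e: "0 < e" using pos by (simp add: e_def)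
  have el: "e \<le> l" using e pos by (simp add: l_def)
  have l: "0 < l" using e el by simp
  have w: "w * e = 216 * l\<^sup>2" by (simp add: w_def l_def power2_eq_square algebra_simps)
  have w0: "0 \<le> w" using l by (simp add: w_def)
  have c: "c1 > 0" "c2 > 0" using pos by (simp_all add: c1_def c2_def)
  have cm: "c1 * int m1 = 12 * l" "c2 * int m2 = 12 * l"
    by (simp_all add: c1_def c2_def l_def e_def)
  obtain s t U where U: "U \<subseteq> {0..<int m1} \<times> {0..<int m2}"
      "\<And>u v. (u, v) \<in> U \<Longrightarrow> (s + c1 * u, t + c2 * v) \<in> tile l e"
      "int (card (tile l e)) \<le> int (card U) * (c1 * c2)"
    using exists_dense_coset[OF c, of "tile l e" "int m1" "int m2"] tile_subset[OF e el] cm by metis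
  define g where "g x = (s + c1 * fst x, t + c2 * snd x)" for x
  have g: "g x \<in> tile l e" if "x \<in> U" for x
    using U(2)[of "fst x" "snd x"] that by (simp add: g_def)
  \<comment> \<open>Dividing by \<open>l\<^sup>2\<close> removes the grid scale: the upper bound
    \<open>648 * n + 72\<close> is at most \<open>720 * n\<close>.\<close>
  define f where "f x = real_of_int (potential l w (g x)) / real_of_int (l\<^sup>2)" for x
  have l2: "0 < real_of_int (l\<^sup>2)" using l by simp
  \<comment> \<open>The density is (42 - 12/n)/144 = 7/24 - 1/(12n).\<close>
  have "7 / 24 * (1 - 2 / (7 * real n)) * (real m1 * real m2) \<le> real (card U)"
  proof -
    have cc: "c1 * c2 = 144 * int n * l" by (simp add: c1_def c2_def l_def e_def)
    have "42 * l\<^sup>2 - 12 * l * e \<le> int (card U) * (144 * int n * l)"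
      using order_trans[OF card_tile[OF e el] U(3)] unfolding cc .
    then have "l * (42 * l - 12 * e) \<le> l * (144 * int n * int (card U))"
      by (simp add: power2_eq_square algebra_simps)
    then have "42 * l - 12 * e \<le> 144 * int n * int (card U)" using l by simp
    then have "real_of_int (42 * l - 12 * e) \<le> real_of_int (144 * int n * int (card U))"
      by (simp only: of_int_le_iff)
    then have "(42 * real n - 12) * (real m1 * real m2) \<le> 144 * real n * real (card U)"
      by (simp add: l_def e_def algebra_simps)
    then show ?thesis using pos by (simp add: field_simps)
  qed
  moreover have "0 \<le> f x \<and> f x \<le> 720 * real n" if "x \<in> U" for x
  proof -
    have "3 * w * l + 72 * l\<^sup>2 \<le> 720 * int n * l\<^sup>2"
      using mult_left_mono[of 1 "int n" "l\<^sup>2"] pos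
      by (simp add: w_def power2_eq_square algebra_simps)
    then have "0 \<le> potential l w (g x)" "potential l w (g x) \<le> 720 * int n * l\<^sup>2"
      using potential_bounds[OF g[OF that] l e w0] by auto
    then have "0 \<le> real_of_int (potential l w (g x))"
      "real_of_int (potential l w (g x)) \<le> real_of_int (720 * int n * l\<^sup>2)"
      by (simp_all only: of_int_le_iff of_int_0_le_iff)
    then show ?thesis using l2 by (simp add: f_def divide_le_eq)
  qed
  moreover have "(if x = z then 0 else 72 / M\<^sup>2) \<le> f x + f z - 2 * f y"
    if xyz: "x \<in> U" "y \<in> U" "z \<in> U"
      and d: "int m1 dvd fst x + fst z - 2 * fst y" "int m2 dvd snd x + snd z - 2 * snd y" for x y z
  proof -
    define gap where "gap = potential l w (g x) + potential l w (g z) - 2 * potential l w (g y)"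
    have f_gap: "f x + f z - 2 * f y = real_of_int gap / real_of_int (l\<^sup>2)"
      by (simp add: f_def gap_def add_divide_distrib diff_divide_distrib)
    have M1: "1 \<le> M" using M pos by linarith
    have d1: "12 * l dvd fst (g x) + fst (g z) - 2 * fst (g y)"
      using mult_dvd_mono[OF dvd_refl[of c1] d(1)] cm by (simp add: g_def algebra_simps)
    have d2: "12 * l dvd snd (g x) + snd (g z) - 2 * snd (g y)"
      using mult_dvd_mono[OF dvd_refl[of c2] d(2)] cm by (simp add: g_def algebra_simps)
    have "216 * l\<^sup>2 \<le> w * e" using w by simp
    from tile_progression[OF l e this w0 g[OF xyz(1)] g[OF xyz(2)] g[OF xyz(3)] d1 d2]
    consider "72 * l\<^sup>2 \<le> gap"
      | "2 * gap = (fst (g x) - fst (g z))\<^sup>2 + (snd (g x) - snd (g z))\<^sup>2"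
      unfolding gap_def by blast
    then show ?thesis
    proof cases
      case 1
      then have "real_of_int (72 * l\<^sup>2) \<le> real_of_int gap" by (simp only: of_int_le_iff)
      then have "72 \<le> f x + f z - 2 * f y" using l2 by (simp add: f_gap le_divide_eq)
      moreover have "72 / M\<^sup>2 \<le> 72" using M1 by (simp add: divide_le_eq)
      ultimately show ?thesis by (cases "x = z") auto
    next
      case 2
      show ?thesis
      proof (cases "x = z")
        case True
        then have "f x + f z - 2 * f y = 0" using 2 f_gap by simp
        then show ?thesis using True by simp
      next
        case False
        \<comment> \<open>Distinct residues modulo \<open>m\<close> are at least
          \<open>c = 12 * l / m\<close> apart in the grid. As \<open>gap\<close> is half the squared
          distance of the ends, this yields the 72 in \<open>72 / M\<^sup>2\<close>.\<close>
        have far: "(12 * real_of_int l / M)\<^sup>2 \<le> real_of_int ((c * u - c * v)\<^sup>2)"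
          if "u \<noteq> v" "c * int m = 12 * l" "c > 0" "0 < m" "real m \<le> M" for c u v :: int and m :: nat
        proof -
          have "1 \<le> \<bar>u - v\<bar>" using that by linarith
          then have "c \<le> \<bar>c * u - c * v\<bar>"
            using mult_left_mono[of 1 "\<bar>u - v\<bar>" c] that(3)
            by (simp add: abs_mult right_diff_distrib[symmetric])
          moreover have "12 * real_of_int l / M \<le> real_of_int c"
          proof -
            have "12 * real_of_int l = real_of_int c * real m"
              using arg_cong[OF that(2), of real_of_int] by simp
            also have "\<dots> \<le> real_of_int c * M" using that by simp
            finally show ?thesis using M1 by (simp add: divide_le_eq)
          qed
          ultimately have "12 * real_of_int l / M \<le> \<bar>real_of_int (c * u - c * v)\<bar>" by linarith
          then have "(12 * real_of_int l / M)\<^sup>2 \<le> \<bar>real_of_int (c * u - c * v)\<bar>\<^sup>2"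
            using l M1 by (intro power_mono) auto
          then show ?thesis by simp
        qed
        have "(12 * real_of_int l / M)\<^sup>2 \<le>
          real_of_int ((c1 * fst x - c1 * fst z)\<^sup>2) + real_of_int ((c2 * snd x - c2 * snd z)\<^sup>2)"
        proof (cases "fst x = fst z")
          case True
          then have "snd x \<noteq> snd z" using \<open>x \<noteq> z\<close> by (simp add: prod_eq_iff)
          from far[OF this cm(2) c(2) pos(2) M(2)] True show ?thesis by simp
        next
          case False
          from far[OF this cm(1) c(1) pos(1) M(1)] show ?thesis
            by (smt (verit) of_int_0_le_iff zero_le_power2)
        qed
        also have "\<dots> = real_of_int (2 * gap)" unfolding 2 by (simp add: g_def)
        finally have "72 / M\<^sup>2 * real_of_int (l\<^sup>2) \<le> real_of_int gap"
          by (simp add: power_divide power_mult_distrib)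
        then show ?thesis using l2 False by (simp add: f_gap le_divide_eq)
      qed
    qed
  qed
  ultimately show ?thesis using U(1) by (intro exI[of _ U] exI[of _ f]) blast
qed

section \<open>Pigeonhole over shells\<close>

text \<open>\<open>R k\<close> stands for being a progression in factor \<open>k\<close>. If the
  ends differ in one factor, the second difference of the summed function is at least
  \<open>\<delta>\<close>, too much for a thin shell. The case \<open>x = z\<close> with another
  midpoint remains possible because of elements of order two, but it is not a progression of
  distinct terms.\<close>

lemma progression_free_shell:
  fixes S :: "nat \<Rightarrow> 'a set" and f :: "nat \<Rightarrow> 'a \<Rightarrow> real"
    and R :: "nat \<Rightarrow> 'a \<Rightarrow> 'a \<Rightarrow> 'a \<Rightarrow> bool"
  assumes fin: "\<And>k. k < K \<Longrightarrow> finite (S k)"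
    and bounds: "\<And>k x. k < K \<Longrightarrow> x \<in> S k \<Longrightarrow> 0 \<le> f k x \<and> f k x \<le> F"
    and gap: "\<And>k x y z. \<lbrakk>k < K; x \<in> S k; y \<in> S k; z \<in> S k; R k x y z\<rbrakk>
      \<Longrightarrow> (if x = z then 0 else \<delta>) \<le> f k x + f k z - 2 * f k y"
    and "\<delta> > 0" "F \<ge> 0"
  obtains A where "A \<subseteq> Pi\<^sub>E {..<K} S"
    "real (\<Prod>k<K. card (S k)) \<le> real (card A) * (2 * real K * F / \<delta> + 1)"
    "\<And>x y z. \<lbrakk>x \<in> A; y \<in> A; z \<in> A; \<And>k. k < K \<Longrightarrow> R k (x k) (y k) (z k)\<rbrakk> \<Longrightarrow> x = z"
proof -
  define G where "G u = (\<Sum>k<K. f k (u k))" for u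
  \<comment> \<open>Shells have width \<open>\<delta> / 2\<close>, since a second difference within
    one shell is less than twice the width.\<close>
  define h where "h u = nat \<lfloor>2 * G u / \<delta>\<rfloor>" for u
  define N where "N = nat \<lfloor>2 * real K * F / \<delta>\<rfloor>"
  let ?P = "Pi\<^sub>E {..<K} S"
  have G: "0 \<le> G u" "G u \<le> real K * F" if "u \<in> ?P" for u
  proof -
    have mem: "u k \<in> S k" if "k < K" for k using \<open>u \<in> ?P\<close> that by auto
    show "0 \<le> G u" unfolding G_def using bounds mem by (intro sum_nonneg) auto
    show "G u \<le> real K * F"
      unfolding G_def using sum_bounded_above[of "{..<K}" "\<lambda>k. f k (u k)" F] bounds mem by simp
  qed
  have "finite ?P" using fin by (intro finite_PiE) auto
  moreover have "h \<in> ?P \<rightarrow> {..N}"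
  proof
    fix u assume "u \<in> ?P"
    then have "2 * G u / \<delta> \<le> 2 * real K * F / \<delta>"
      using G[of u] \<open>\<delta> > 0\<close> by (intro divide_right_mono) auto
    then show "h u \<in> {..N}" unfolding h_def N_def by (simp add: floor_mono nat_mono)
  qed
  ultimately obtain j where j: "card ?P \<le> card (h -` {j} \<inter> ?P) * card {..N}"
    using pigeonhole_card[of h ?P "{..N}"] by auto
  define A where "A = h -` {j} \<inter> ?P"
  have "x = z" if A: "x \<in> A" "y \<in> A" "z \<in> A" and R: "\<And>k. k < K \<Longrightarrow> R k (x k) (y k) (z k)" for x y z
  proof (rule ccontr)
    assume "x \<noteq> z"
    have P: "x \<in> ?P" "y \<in> ?P" "z \<in> ?P" using A by (auto simp: A_def)
    with \<open>x \<noteq> z\<close> obtain k0 where k0: "k0 < K" "x k0 \<noteq> z k0"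
      by (metis PiE_ext lessThan_iff)
    let ?d = "\<lambda>k. f k (x k) + f k (z k) - 2 * f k (y k)"
    have d: "(if x k = z k then 0 else \<delta>) \<le> ?d k" if "k < K" for k
      using that P R by (intro gap) auto
    have "\<delta> \<le> ?d k0" using d[OF k0(1)] k0(2) by simp
    also have "?d k0 \<le> (\<Sum>k<K. ?d k)"
    proof (intro member_le_sum)
      show "0 \<le> ?d k" if "k \<in> {..<K} - {k0}" for k
        using d[of k] that \<open>\<delta> > 0\<close> by (cases "x k = z k") auto
    qed (use k0 in auto)
    also have "\<dots> = G x + G z - 2 * G y"
      by (simp add: G_def sum.distrib sum_subtractf sum_distrib_left)
    finally have large: "\<delta> \<le> G x + G z - 2 * G y" .
    have shell: "real j * \<delta> \<le> 2 * G u" "2 * G u < real j * \<delta> + \<delta>" if "u \<in> A" for u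
    proof -
      have "0 \<le> 2 * G u / \<delta>" using that G[of u] \<open>\<delta> > 0\<close> by (simp add: A_def)
      moreover have "h u = j" using that by (simp add: A_def)
      ultimately have "\<lfloor>2 * G u / \<delta>\<rfloor> = int j" unfolding h_def by auto
      then have "real j \<le> 2 * G u / \<delta>" "2 * G u / \<delta> < real j + 1"
        by (simp_all add: floor_eq_iff)
      then show "real j * \<delta> \<le> 2 * G u" "2 * G u < real j * \<delta> + \<delta>"
        using \<open>\<delta> > 0\<close> by (simp_all add: field_simps)
    qed
    from large shell[OF A(1)] shell[OF A(2)] shell[OF A(3)] show False by linarith
  qed
  moreover have "real (\<Prod>k<K. card (S k)) \<le> real (card A) * (2 * real K * F / \<delta> + 1)"
  proof -
    have "real (card ?P) \<le> real (card A) * real (card {..N})"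
      using j unfolding A_def by (metis of_nat_le_iff of_nat_mult)
    also have "\<dots> \<le> real (card A) * (2 * real K * F / \<delta> + 1)"
    proof (intro mult_left_mono)
      have "0 \<le> 2 * real K * F / \<delta>" using assms(4,5) by simp
      then have "real N \<le> 2 * real K * F / \<delta>" by (simp add: N_def)
      then show "real (card {..N}) \<le> 2 * real K * F / \<delta> + 1" by simp
    qed simp
    finally show ?thesis by (simp add: card_PiE)
  qed
  moreover have "A \<subseteq> ?P" by (simp add: A_def)
  ultimately show thesis using that[of A] by metis
qed

section \<open>Assembling the pairs of coordinates\<close>

lemma prod_consecutive_pairs:
  fixes g :: "nat \<Rightarrow> 'a::comm_monoid_mult"
  shows "(\<Prod>k<K. g (2 * k + 1) * g (2 * k + 2)) = (\<Prod>i=1..2 * K. g i)"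
  by (induction K) (simp_all add: mult.assoc)

text \<open>One factor 1/2 pays for the strips, by Bernoulli with \<open>K \<le> n\<close>. The
  other pays for rounding \<open>n / 2\<close> up to \<open>K\<close>, which costs at most a factor
  sqrt(7/24), and that is at least 1/2.\<close>

lemma block_constant_bound:
  fixes n K :: nat
  assumes n: "n > 0" and K: "K = (n + 1) div 2"
  shows "(7 / 24) powr (real n / 2) / 4 \<le> (7 / 24 * (1 - 2 / (7 * real n))) ^ K"
proof -
  have "- (2 / (7 * real n)) \<ge> -1" using n by (simp add: field_simps)
  from Bernoulli_inequality[OF this, of K]
  have "1 - real K * (2 / (7 * real n)) \<le> (1 - 2 / (7 * real n)) ^ K" by simp
  moreover have "2 * real K \<le> 2 * real n" using n K by linarith
  then have "real K * (2 / (7 * real n)) \<le> 2 / 7" using n by (simp add: field_simps)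
  ultimately have "1 / 2 \<le> (1 - 2 / (7 * real n)) ^ K" by linarith
  moreover have "(7 / 24) powr (real n / 2) / 2 \<le> (7 / 24 :: real) ^ K"
  proof -
    have "real K \<le> real n / 2 + 1 / 2" unfolding K by linarith
    then have "(7 / 24 :: real) powr (real n / 2 + 1 / 2) \<le> (7 / 24) powr real K"
      by (intro powr_mono') auto
    moreover have "(1 / 2 :: real) \<le> (7 / 24) powr (1 / 2)"
      unfolding powr_half_sqrt[of "7 / 24 :: real", simplified]
      by (rule real_le_rsqrt) (simp add: power2_eq_square)
    then have "(7 / 24) powr (real n / 2) * (1 / 2) \<le> (7 / 24 :: real) powr (real n / 2 + 1 / 2)"
      unfolding powr_add by (intro mult_left_mono) auto
    ultimately show ?thesis by (simp add: powr_realpow)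
  qed
  ultimately have "(7 / 24) powr (real n / 2) / 2 * (1 / 2) \<le> (7 / 24) ^ K * (1 - 2 / (7 * real n)) ^ K"
    by (intro mult_mono) auto
  then show ?thesis unfolding power_mult_distrib by simp
qed

theorem theorem1p3:
  fixes n :: nat and m :: "nat \<Rightarrow> nat" and M :: real
  assumes "n > 0"
    and "\<And>i. i \<in> {1..n} \<Longrightarrow> 2 \<le> m i \<and> real (m i) \<le> M"
  shows "real (r3 (cyclic_product n m)) \<ge>
           (7 / 24) powr (real n / 2) / (10 ^ 6 * M\<^sup>2 * real n ^ 3) * (\<Prod>i=1..n. real (m i))"
proof -
  define K where "K = (n + 1) div 2"
  \<comment> \<open>For odd \<open>n\<close> the last pair is completed by a modulus 1, the trivial
    group.\<close>
  define p where "p i = (if i \<in> {1..n} then m i else 1)" for i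
  have M2: "2 \<le> M" using assms(2)[of 1] assms(1) by auto
  have p: "0 < p i" "real (p i) \<le> M" for i
    using assms(2)[of i] M2 by (auto simp: p_def)
  define T where "T k = {0..<int (p (2 * k + 1))} \<times> {0..<int (p (2 * k + 2))}" for k
  define R where "R k x y z \<longleftrightarrow> int (p (2 * k + 1)) dvd fst x + fst z - 2 * fst y \<and>
    int (p (2 * k + 2)) dvd snd x + snd z - 2 * snd y" for k and x y z :: "int \<times> int"
  have "\<forall>k. \<exists>S f. S \<subseteq> T k \<and>
      7 / 24 * (1 - 2 / (7 * real n)) * (real (p (2 * k + 1)) * real (p (2 * k + 2))) \<le> real (card S) \<and>
      (\<forall>x\<in>S. 0 \<le> f x \<and> f x \<le> 720 * real n) \<and>
      (\<forall>x\<in>S. \<forall>y\<in>S. \<forall>z\<in>S. R k x y z \<longrightarrow>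
        (if x = z then 0 else 72 / M\<^sup>2) \<le> f x + f z - 2 * f y)"
    unfolding T_def R_def imp_conjL
    using exists_convex_block[OF p(1) p(1) assms(1) p(2) p(2)] by blast
  then obtain S f where S: "\<And>k. S k \<subseteq> T k"
      "\<And>k. 7 / 24 * (1 - 2 / (7 * real n)) * (real (p (2 * k + 1)) * real (p (2 * k + 2))) \<le> real (card (S k))"
    and f: "\<And>k x. x \<in> S k \<Longrightarrow> 0 \<le> f k x \<and> f k x \<le> 720 * real n"
      "\<And>k x y z. \<lbrakk>x \<in> S k; y \<in> S k; z \<in> S k; R k x y z\<rbrakk>
        \<Longrightarrow> (if x = z then 0 else 72 / M\<^sup>2) \<le> f k x + f k z - 2 * f k y"
    by metis
  obtain A where A: "A \<subseteq> Pi\<^sub>E {..<K} S"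
      "real (\<Prod>k<K. card (S k)) \<le> real (card A) * (2 * real K * (720 * real n) / (72 / M\<^sup>2) + 1)"
      "\<And>x y z. \<lbrakk>x \<in> A; y \<in> A; z \<in> A; \<And>k. k < K \<Longrightarrow> R k (x k) (y k) (z k)\<rbrakk> \<Longrightarrow> x = z"
  proof (rule progression_free_shell[of K S f "720 * real n" R "72 / M\<^sup>2"])
    show "finite (S k)" for k
      using finite_subset[OF S(1)[of k]] by (simp add: T_def)
    show "0 \<le> f k x \<and> f k x \<le> 720 * real n" if "x \<in> S k" for k x
      using f(1)[OF that] .
    show "(if x = z then 0 else 72 / M\<^sup>2) \<le> f k x + f k z - 2 * f k y"
      if "x \<in> S k" "y \<in> S k" "z \<in> S k" "R k x y z" for k x y z
      using f(2)[OF that] .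
    fix A
    assume "A \<subseteq> Pi\<^sub>E {..<K} S"
      "real (\<Prod>k<K. card (S k)) \<le> real (card A) * (2 * real K * (720 * real n) / (72 / M\<^sup>2) + 1)"
      "\<And>x y z. \<lbrakk>x \<in> A; y \<in> A; z \<in> A; \<And>k. k < K \<Longrightarrow> R k (x k) (y k) (z k)\<rbrakk> \<Longrightarrow> x = z"
    then show thesis by (rule that)
  qed (use M2 in simp_all)
  \<comment> \<open>Flattens pairs: pair \<open>k\<close> occupies the coordinates
    \<open>2 * k + 1\<close> and \<open>2 * k + 2\<close>, and a padded last one is
    discarded.\<close>
  define \<Phi> where "\<Phi> u = (\<lambda>i\<in>{1..n}. if odd i then fst (u (i div 2)) else snd (u (i div 2 - 1)))"
    for u :: "nat \<Rightarrow> int \<times> int"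
  have odd_idx: "2 * k + 1 \<in> {1..n}" if "k < K" for k using that by (auto simp: K_def)
  have \<Phi>1: "\<Phi> u (2 * k + 1) = fst (u k)" if "k < K" for u k
    using odd_idx[OF that] by (simp add: \<Phi>_def)
  have \<Phi>2: "\<Phi> u (2 * k + 2) = snd (u k)" if "2 * k + 2 \<le> n" for u k
    using that by (simp add: \<Phi>_def)
  have u: "u k \<in> T k" if "u \<in> A" "k < K" for u k
    using that A(1) S(1)[of k] by auto
  have inj: "inj_on \<Phi> A"
  proof (rule inj_onI)
    fix u v assume uv: "u \<in> A" "v \<in> A" "\<Phi> u = \<Phi> v"
    have "u k = v k" if "k < K" for k
    proof (rule prod_eqI)
      show "fst (u k) = fst (v k)" using \<Phi>1[OF that] uv(3) by metis
      show "snd (u k) = snd (v k)"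
      proof (cases "2 * k + 2 \<le> n")
        case True
        then show ?thesis using \<Phi>2 uv(3) by metis
      next
        case False
        \<comment> \<open>The discarded coordinate can only be 0, so no information is lost.\<close>
        then have "p (2 * k + 2) = 1" by (simp add: p_def)
        then show ?thesis using u[OF uv(1) that] u[OF uv(2) that] by (auto simp: T_def)
      qed
    qed
    moreover have "u \<in> Pi\<^sub>E {..<K} S" "v \<in> Pi\<^sub>E {..<K} S" using uv A(1) by auto
    ultimately show "u = v" by (auto intro: PiE_ext)
  qed
  have carrier: "\<Phi> ` A \<subseteq> carrier (cyclic_product n m)"
  proof (clarsimp simp: cyclic_product_def)
    fix v assume v: "v \<in> A"
    show "\<Phi> v \<in> (\<Pi>\<^sub>E i\<in>{Suc 0..n}. carrier (integer_mod_group (m i)))"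
    proof (rule PiE_I)
      fix i assume i: "i \<in> {Suc 0..n}"
      show "\<Phi> v i \<in> carrier (integer_mod_group (m i))"
      proof (cases "odd i")
        case True
        then obtain k where k: "i = 2 * k + 1" by (elim oddE)
        then have "k < K" using i by (auto simp: K_def)
        then show ?thesis using \<Phi>1[of k v] u[OF v, of k] i
          by (auto simp: k T_def p_def carrier_integer_mod_group)
      next
        case False
        then obtain k' where "i = 2 * k'" by auto
        with i obtain k where k: "i = 2 * k + 2" by (cases k') auto
        then have "k < K" using i by (auto simp: K_def)
        then show ?thesis using \<Phi>2[of k v] u[OF v, of k] i
          by (auto simp: k T_def p_def carrier_integer_mod_group)
      qed
    qed (auto simp: \<Phi>_def)
  qed
  have "three_AP_free (cyclic_product n m) (\<Phi> ` A)"
    unfolding three_AP_free_def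
  proof clarify
    fix x y z
    assume xyz: "x \<in> A" "y \<in> A" "z \<in> A" and ne: "\<Phi> x \<noteq> \<Phi> z"
      and eq: "\<Phi> x \<otimes>\<^bsub>cyclic_product n m\<^esub> \<Phi> z = \<Phi> y \<otimes>\<^bsub>cyclic_product n m\<^esub> \<Phi> y"
    have dvd: "int (m i) dvd \<Phi> x i + \<Phi> z i - 2 * \<Phi> y i" if "i \<in> {1..n}" for i
    proof -
      have "(\<Phi> x i + \<Phi> z i) mod int (m i) = (\<Phi> y i + \<Phi> y i) mod int (m i)"
        using fun_cong[OF eq, of i] that by (simp add: cyclic_product_def)
      then show ?thesis by (simp add: mod_eq_dvd_iff)
    qed
    have "R k (x k) (y k) (z k)" if "k < K" for k
      unfolding R_def
    proof
      show "int (p (2 * k + 1)) dvd fst (x k) + fst (z k) - 2 * fst (y k)"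
        using dvd[OF odd_idx[OF that]] \<Phi>1[OF that] odd_idx[OF that] by (simp add: p_def)
      show "int (p (2 * k + 2)) dvd snd (x k) + snd (z k) - 2 * snd (y k)"
      proof (cases "2 * k + 2 \<le> n")
        case True
        then show ?thesis using dvd[of "2 * k + 2"] \<Phi>2[OF True] by (simp add: p_def)
      qed (simp add: p_def)
    qed
    then have "x = z" using A(3) xyz by blast
    with ne show False by simp
  qed
  moreover have "finite (carrier (cyclic_product n m))"
    using assms(2) by (intro finite_cyclic_product) fastforce
  ultimately have "card A \<le> r3 (cyclic_product n m)"
    using card_le_r3[OF _ carrier] card_image[OF inj] by simp
  define c where "c = (7 / 24) powr (real n / 2)"
  define P where "P = (\<Prod>i=1..n. real (m i))"
  have P0: "0 \<le> P" unfolding P_def by (intro prod_nonneg) auto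
  have "(\<Prod>i=1..2 * K. real (p i)) = P"
  proof -
    have "{1..n} \<subseteq> {1..2 * K}" by (auto simp: K_def)
    then have "(\<Prod>i=1..2 * K. real (p i)) = (\<Prod>i=1..n. real (p i))"
      by (intro prod.mono_neutral_right) (auto simp: p_def)
    then show ?thesis by (simp add: P_def p_def)
  qed
  then have "(\<Prod>k<K. real (p (2 * k + 1)) * real (p (2 * k + 2))) = P"
    using prod_consecutive_pairs[of "\<lambda>i. real (p i)" K] by metis
  then have "(7 / 24 * (1 - 2 / (7 * real n))) ^ K * P =
      (\<Prod>k<K. 7 / 24 * (1 - 2 / (7 * real n)) * (real (p (2 * k + 1)) * real (p (2 * k + 2))))"
    unfolding prod.distrib[of "\<lambda>_. 7 / 24 * (1 - 2 / (7 * real n))"] prod_constant card_lessThan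
    by simp
  also have "\<dots> \<le> (\<Prod>k<K. real (card (S k)))"
  proof (intro prod_mono conjI mult_nonneg_nonneg S(2))
    show "0 \<le> 1 - 2 / (7 * real n)" using assms(1) by (simp add: divide_le_eq)
  qed auto
  also have "\<dots> \<le> real (card A) * (2 * real K * (720 * real n) / (72 / M\<^sup>2) + 1)"
    using A(2) by simp
  finally have "c / 4 * P \<le> real (card A) * (2 * real K * (720 * real n) / (72 / M\<^sup>2) + 1)"
    using mult_right_mono[OF block_constant_bound[OF assms(1) K_def] P0] by (simp add: c_def)
  also have "\<dots> \<le> real (card A) * (21 * real n ^ 3 * M\<^sup>2)"
  \<comment> \<open>The shell count is at most \<open>20 * K * n * M\<^sup>2 + 1\<close>, because 2
    * 720 / 72 = 20.\<close>
  proof (intro mult_left_mono)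
    have n1: "1 \<le> real n" using assms(1) by simp
    have K1: "real K \<le> real n" using assms(1) by (simp add: K_def)
    have M1: "1 \<le> M\<^sup>2" using M2 by (simp add: one_le_power)
    have "real K * real n \<le> real n * real n" using K1 by (intro mult_right_mono) auto
    also have "\<dots> \<le> real n ^ 3" using n1 by (simp add: power3_eq_cube)
    finally have "20 * (real K * real n) * M\<^sup>2 \<le> 20 * real n ^ 3 * M\<^sup>2"
      by (intro mult_right_mono) auto
    moreover have "1 \<le> real n ^ 3 * M\<^sup>2"
      using mult_mono[OF one_le_power[OF n1, of 3] M1] by simp
    ultimately show "2 * real K * (720 * real n) / (72 / M\<^sup>2) + 1 \<le> 21 * real n ^ 3 * M\<^sup>2"
      by (simp add: algebra_simps)
  qed simp
  finally have main: "c / 4 * P \<le> real (card A) * (21 * real n ^ 3 * M\<^sup>2)" .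
  have D: "0 < real n ^ 3 * M\<^sup>2" using assms(1) M2 by simp
  have "c * P \<le> real (card A) * (84 * (real n ^ 3 * M\<^sup>2))" using main by simp
  \<comment> \<open>The accumulated constant is 84 = 4 * 21, well below
    \<open>10 ^ 6\<close>.\<close>
  also have "\<dots> \<le> real (card A) * (10 ^ 6 * (real n ^ 3 * M\<^sup>2))"
    using D by (intro mult_left_mono mult_right_mono) auto
  finally have "c * P / (10 ^ 6 * M\<^sup>2 * real n ^ 3) \<le> real (card A)"
    using D by (simp add: divide_le_eq algebra_simps)
  also have "\<dots> \<le> real (r3 (cyclic_product n m))"
    using \<open>card A \<le> r3 (cyclic_product n m)\<close> by simp
  finally show ?thesis by (simp add: c_def P_def)
qed

end
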